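(* Fix an integer $\kappa\ge1$ and let $2<p<\infty$. Then almost surely the limit $\mathbf{GSE}_p=\lim_{N\to\infty}\mathbf{GSE}_{N,p}$ exists and is given by $$\mathbf{GSE}_p=\frac p2\Big(\frac p2-1\Big)^{\frac2p-1}t^{\frac2p}L_p(t)^{1-\frac2p}$$ for every $t>0$.
   Context: Let $(g_{ij})_{i,j\ge1}$ be independent standard Gaussian random variables. For $\sigma=(\sigma_1,\dots,\sigma_N)\in(\mathbb{R}^\kappa)^N$ put $$H_N(\sigma)=\frac1{\sqrt N}\sum_{i,j=1}^N g_{ij}(\sigma_i,\sigma_j),\qquad \|\sigma\|_{p,2}^p=\sum_{i=1}^N\|\sigma_i\|_2^p,$$ where $(\cdot,\cdot)$ and $\|\cdot\|_2$ are the Euclidean inner product and norm on $\mathbb{R}^\kappa$. The ground state energy is $$\mathbf{GSE}_{N,p}=\frac1N\max\Big\{H_N(\sigma):\sigma\in(\mathbb{R}^\kappa)^N,\ \frac1N\|\sigma\|_{p,2}^p=1\Big\},$$ equivalently $\mathbf{GSE}_{N,p}=N^{\frac2p-\frac32}\max\{\sum_{i,j}g_{ij}(\sigma_i,\sigma_j):\|\sigma\|_{p,2}=1\}$. For $t>0$ the unconstrained Lagrangian is $L_{N,p}(t)=\frac1N\max_{\sigma\in(\mathbb{R}^\kappa)^N}\big(H_N(\sigma)-t\|\sigma\|_{p,2}^p\big)$, and $L_p(t)$ denotes its almost sure limit as $N\to\infty$, which exists (almost surely, simultaneously for all $t>0$) and is deterministic. *)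

theory Defs
  imports "HOL-Probability.Probability"
begin

text \<open>
  Configurations \<open>\<sigma> = (\<sigma>\<^sub>1, \<dots>, \<sigma>\<^sub>N)\<close> in \<open>(\<real>\<^sup>\<kappa>)\<^sup>N\<close>; here \<open>\<kappa> = CARD('k)\<close>, so that \<open>\<kappa> \<ge> 1\<close>
  is automatic.
\<close>
definition configs :: "nat \<Rightarrow> (nat \<Rightarrow> real ^ 'k) set" where
  "configs N = ({1..N} \<rightarrow>\<^sub>E UNIV)"

definition hamiltonian :: "nat \<Rightarrow> (nat \<Rightarrow> nat \<Rightarrow> real) \<Rightarrow> (nat \<Rightarrow> real ^ 'k) \<Rightarrow> real" where
  "hamiltonian N a \<sigma> = 1 / sqrt (real N) * (\<Sum>i=1..N. \<Sum>j=1..N. a i j * (\<sigma> i \<bullet> \<sigma> j))"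

text \<open>The \<open>p\<close>-th power \<open>\<parallel>\<sigma>\<parallel>\<^sup>p\<close> of the \<open>(p,2)\<close>-norm, not the norm itself.\<close>
definition norm_p2_pow :: "real \<Rightarrow> nat \<Rightarrow> (nat \<Rightarrow> real ^ 'k) \<Rightarrow> real" where
  "norm_p2_pow p N \<sigma> = (\<Sum>i=1..N. norm (\<sigma> i) powr p)"

text \<open>
  The maximum of \<open>f\<close> on a possibly infinite set (\<^const>\<open>Max\<close> only handles finite sets).
  It is meaningful only if the maximum is attained; in particular \<open>N = 0\<close> below gives a junk
  value of the ground state energy, which does not affect limits.
\<close>
definition max_on :: "('a \<Rightarrow> real) \<Rightarrow> 'a set \<Rightarrow> real" where
  "max_on f S = (GREATEST y. y \<in> f ` S)"

text \<open>The type argument carries \<open>\<kappa>\<close>, which is not visible in the type of the result.\<close>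
definition ground_state_energy ::
    "'k::finite itself \<Rightarrow> real \<Rightarrow> nat \<Rightarrow> (nat \<Rightarrow> nat \<Rightarrow> real) \<Rightarrow> real" where
  "ground_state_energy _ p N a =
     1 / real N * max_on (hamiltonian N a)
       {\<sigma> \<in> (configs N :: (nat \<Rightarrow> real ^ 'k) set). 1 / real N * norm_p2_pow p N \<sigma> = 1}"

definition lagrangian ::
    "'k::finite itself \<Rightarrow> real \<Rightarrow> nat \<Rightarrow> (nat \<Rightarrow> nat \<Rightarrow> real) \<Rightarrow> real \<Rightarrow> real" where
  "lagrangian _ p N a t =
     1 / real N * max_on (\<lambda>\<sigma>. hamiltonian N a \<sigma> - t * norm_p2_pow p N \<sigma>)
       (configs N :: (nat \<Rightarrow> real ^ 'k) set)"

end

theory Submission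
  imports Defs
begin

text \<open>
  The Hamiltonian is 2-homogeneous and the penalty is \<open>p\<close>-homogeneous, so maximising first over
  rays and then over the sphere expresses \<open>L\<^sub>N\<^sub>,\<^sub>p(t)\<close> as the maximum of
  \<open>G u - t u\<^bsup>p/2\<^esup>\<close> over \<open>u \<ge> 0\<close>, where \<open>G\<close> is the positive part of the ground state energy. By
  Young's inequality this maximum is an explicit power of \<open>G\<close>, and inverting it gives the
  formula for each fixed \<open>N\<close>. The negative part of the ground state energy disappears in the
  limit, because putting all the mass on one coordinate shows that the energy is at least
  \<open>N\<^bsup>2/p-3/2\<^esup> g\<^sub>1\<^sub>1\<close>, and \<open>2/p < 3/2\<close>.
\<close>

section \<open>The scalar problem: maximise \<open>G * u - t * u powr (p / 2)\<close> over
  \<open>u\<close> \<ge> 0\<close>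

definition dual_value :: "real \<Rightarrow> real \<Rightarrow> real \<Rightarrow> real" where
  "dual_value p t G = (1 - 2 / p) * (2 / (p * t)) powr (2 / (p - 2)) * G powr (p / (p - 2))"

text \<open>The solution of the critical point equation
  \<open>G = p * t / 2 * u powr (p / 2 - 1)\<close>.\<close>

definition dual_point :: "real \<Rightarrow> real \<Rightarrow> real \<Rightarrow> real" where
  "dual_point p t G = (2 * G / (p * t)) powr (2 / (p - 2))"

lemma dual_value_ge:
  assumes "p > 2" "t > 0" "G \<ge> 0" "u \<ge> 0"
  shows "G * u - t * u powr (p / 2) \<le> dual_value p t G"
proof -
  \<comment> \<open>Young's inequality is applied to \<open>c * u\<close> and \<open>G / c\<close>
    with conjugate exponents \<open>p / 2\<close> and \<open>q\<close>; this \<open>c\<close> makes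
    its first term exactly \<open>t * u powr (p / 2)\<close>.\<close>
  define c where "c = (p * t / 2) powr (2 / p)"
  define q where "q = p / (p - 2)"
  have c: "c > 0" and c_p: "c powr (p / 2) = p * t / 2"
    using assms by (auto simp: c_def powr_powr)
  have "q > 1" "1 / (p / 2) + 1 / q = 1"
    using assms by (auto simp: q_def field_simps)
  then have "(c * u) * (G / c) \<le> (c * u) powr (p / 2) / (p / 2) + (G / c) powr q / q"
    using assms c by (intro Youngs_inequality) auto
  moreover have "(c * u) * (G / c) = G * u"
    using c by simp
  moreover have "(c * u) powr (p / 2) / (p / 2) = t * u powr (p / 2)"
  proof -
    have "(c * u) powr (p / 2) = p * t / 2 * u powr (p / 2)"
      unfolding c_p[symmetric] using assms c by (simp add: powr_mult)
    then show ?thesis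
      using assms by simp
  qed
  moreover have "(G / c) powr q / q = dual_value p t G"
  proof -
    have "c powr q = (p * t / 2) powr (2 / (p - 2))"
      using assms by (simp add: c_def q_def powr_powr)
    moreover have "(2 / (p * t)) powr (2 / (p - 2)) = 1 / (p * t / 2) powr (2 / (p - 2))"
      using assms powr_divide[of 1 "p * t / 2" "2 / (p - 2)"] by simp
    moreover have "1 / q = 1 - 2 / p"
      using assms by (simp add: q_def field_simps)
    moreover have "(G / c) powr q / q = 1 / q * (1 / c powr q) * G powr q"
      using assms c by (simp add: powr_divide)
    ultimately show ?thesis
      unfolding dual_value_def q_def[symmetric] by (simp only:)
  qed
  ultimately show ?thesis by linarith
qed

text \<open>At the critical point the penalty is the fraction \<open>2 / p\<close> of the linear
  term, so \<open>1 - 2 / p\<close> of that term remains.\<close>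

lemma dual_value_attained:
  assumes "p > 2" "t > 0" "G \<ge> 0"
  shows "G * dual_point p t G - t * dual_point p t G powr (p / 2) = dual_value p t G"
proof (cases "G = 0")
  case False
  define A where "A = (2 / (p * t)) powr (2 / (p - 2))"
  have e: "p / (p - 2) = 1 + 2 / (p - 2)"
    using assms by (simp add: field_simps)
  have u: "dual_point p t G = A * G powr (2 / (p - 2))"
    using assms by (simp add: dual_point_def A_def flip: powr_mult)
  have "dual_point p t G powr (p / 2) = (2 * G / (p * t)) powr (p / (p - 2))"
    using assms unfolding dual_point_def powr_powr
    by (intro arg_cong[where f = "(powr) _"]) (simp add: field_simps)
  also have "\<dots> = (2 * G / (p * t)) * dual_point p t G"
    using assms False unfolding e by (simp add: dual_point_def powr_add)
  finally have "t * dual_point p t G powr (p / 2) = (2 / p) * (G * dual_point p t G)"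
    using assms by simp
  moreover have "G * dual_point p t G = A * G powr (p / (p - 2))"
    using assms False unfolding e u by (simp add: powr_add)
  ultimately show ?thesis
    unfolding dual_value_def A_def[symmetric] by (simp add: algebra_simps)
qed (simp add: dual_point_def dual_value_def)

text \<open>The exponent \<open>1 - 2 / p\<close> is the reciprocal of \<open>p / (p - 2)\<close>,
  so the left side is linear in \<open>G\<close>; the prefactors are chosen to make the slope
  1.\<close>

lemma dual_value_inverse:
  assumes "p > 2" "t > 0" "G \<ge> 0"
  shows "p / 2 * (p / 2 - 1) powr (2 / p - 1) * t powr (2 / p)
           * dual_value p t G powr (1 - 2 / p) = G"
proof (cases "G = 0")
  case False
  have e: "2 / (p - 2) * (1 - 2 / p) = 2 / p" "p / (p - 2) * (1 - 2 / p) = 1"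
    using assms by (auto simp: field_simps)
  have "dual_value p t G powr (1 - 2 / p)
      = (1 - 2 / p) powr (1 - 2 / p) * (2 / (p * t)) powr (2 / p) * G"
    using assms False unfolding dual_value_def by (simp add: powr_mult powr_powr e del: times_divide_eq_left)
  moreover have "p / 2 * (p / 2 - 1) powr (2 / p - 1) * t powr (2 / p)
      * ((1 - 2 / p) powr (1 - 2 / p) * (2 / (p * t)) powr (2 / p)) = 1"
  proof -
    \<comment> \<open>Everything is written through \<open>ln (p / 2 - 1)\<close>,
      \<open>ln (p / 2)\<close> and \<open>ln t\<close>; the coefficient of each then adds up to
      0.\<close>
    have "1 - 2 / p = (p / 2 - 1) * (2 / p)"
      using assms by (simp add: field_simps)
    then have "ln (1 - 2 / p) = ln (p / 2 - 1) + ln (2 / p)"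
      using assms by (simp only:) (subst ln_mult, auto)
    moreover have "ln (2 / p) = - ln (p / 2)"
      using assms by (simp add: ln_div)
    moreover have "ln (2 / (p * t)) = - ln (p / 2) - ln t"
      using assms by (simp add: ln_div ln_mult)
    moreover have "p / 2 = exp (ln (p / 2))"
      using assms by simp
    ultimately have "p / 2 * (p / 2 - 1) powr (2 / p - 1) * t powr (2 / p)
      * ((1 - 2 / p) powr (1 - 2 / p) * (2 / (p * t)) powr (2 / p))
      = exp (ln (p / 2) + (2 / p - 1) * ln (p / 2 - 1) + 2 / p * ln t
          + ((1 - 2 / p) * (ln (p / 2 - 1) - ln (p / 2)) + 2 / p * (- ln (p / 2) - ln t)))"
      using assms unfolding exp_add powr_def by simp
    also have "\<dots> = exp 0"
      by (rule arg_cong[where f = exp]) (simp add: algebra_simps)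
    finally show ?thesis by simp
  qed
  ultimately show ?thesis
    by (simp only: mult.assoc[symmetric] mult_1)
qed (simp add: dual_value_def)

section \<open>Homogeneity under scaling\<close>

text \<open>The restriction to \<open>{1..N}\<close> keeps the value \<open>undefined\<close>
  elsewhere, as \<open>configs N\<close> demands; plain pointwise scaling would change it.\<close>

definition scale_config :: "nat \<Rightarrow> real \<Rightarrow> (nat \<Rightarrow> real ^ 'k) \<Rightarrow> nat \<Rightarrow> real ^ 'k" where
  "scale_config N s \<sigma> = (\<lambda>i\<in>{1..N}. s *\<^sub>R \<sigma> i)"

lemma scale_config_in_configs: "scale_config N s \<sigma> \<in> configs N"
  by (auto simp: scale_config_def configs_def)

lemma hamiltonian_scale_config:
  "hamiltonian N a (scale_config N s \<sigma>) = s\<^sup>2 * hamiltonian N a \<sigma>"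
  by (simp add: hamiltonian_def scale_config_def sum_distrib_left power2_eq_square mult_ac)

lemma norm_p2_pow_scale_config:
  assumes "s \<ge> 0"
  shows "norm_p2_pow p N (scale_config N s \<sigma>) = s powr p * norm_p2_pow p N \<sigma>"
  using assms by (simp add: norm_p2_pow_def scale_config_def sum_distrib_left powr_mult)

lemma norm_p2_pow_nonneg: "norm_p2_pow p N \<sigma> \<ge> 0"
  by (simp add: norm_p2_pow_def sum_nonneg)

lemma max_on_eqI:
  assumes "x \<in> S" "\<And>y. y \<in> S \<Longrightarrow> f y \<le> f x"
  shows "max_on f S = f x"
  unfolding max_on_def using assms by (intro Greatest_equality) auto

section \<open>The constraint sphere: test point, compactness, attained maximum\<close>

definition unit_sphere_p2 :: "real \<Rightarrow> nat \<Rightarrow> (nat \<Rightarrow> real ^ 'k) set" where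
  "unit_sphere_p2 p N = {\<sigma> \<in> configs N. 1 / real N * norm_p2_pow p N \<sigma> = 1}"

text \<open>The whole mass \<open>N\<close> sits on site 1; \<open>axis undefined 1\<close> is a
  unit vector in an arbitrary coordinate direction. It shows that the sphere is nonempty and bounds
  the energy from below.\<close>

definition one_site_config :: "real \<Rightarrow> nat \<Rightarrow> nat \<Rightarrow> real ^ 'k" where
  "one_site_config p N =
     (\<lambda>i\<in>{1..N}. if i = 1 then (real N powr (1 / p)) *\<^sub>R axis undefined 1 else 0)"

lemma one_site_config_in_sphere:
  assumes "p > 0" "N \<ge> 1"
  shows "(one_site_config p N :: nat \<Rightarrow> real ^ 'k::finite) \<in> unit_sphere_p2 p N"
proof -
  let ?\<sigma> = "one_site_config p N :: nat \<Rightarrow> real ^ 'k"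
  have "norm_p2_pow p N ?\<sigma> =
      (\<Sum>i=1..N. if i = 1 then real N else 0)"
    unfolding norm_p2_pow_def using assms
    by (intro sum.cong) (auto simp: one_site_config_def powr_powr)
  also have "\<dots> = real N"
    using assms by (subst sum.delta) auto
  finally have "1 / real N * norm_p2_pow p N ?\<sigma> = 1"
    using assms by simp
  moreover have "?\<sigma> \<in> configs N"
    by (auto simp: configs_def one_site_config_def)
  ultimately show ?thesis
    unfolding unit_sphere_p2_def by blast
qed

lemma hamiltonian_one_site_config:
  assumes "p > 0" "N \<ge> 1"
  shows "hamiltonian N a (one_site_config p N :: nat \<Rightarrow> real ^ 'k::finite)
           = real N powr (2 / p - 1 / 2) * a 1 1"
proof -
  let ?\<sigma> = "one_site_config p N :: nat \<Rightarrow> real ^ 'k"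
  have "(\<Sum>i=1..N. \<Sum>j=1..N. a i j * (?\<sigma> i \<bullet> ?\<sigma> j))
      = (\<Sum>i=1..N. \<Sum>j=1..N. if j = 1 then (if i = 1 then a 1 1 * real N powr (2 / p) else 0) else 0)"
    by (intro sum.cong) (auto simp: one_site_config_def inner_axis_axis simp flip: powr_add)
  also have "\<dots> = a 1 1 * real N powr (2 / p)"
    using assms by simp
  finally show ?thesis
    using assms by (simp add: hamiltonian_def powr_diff powr_half_sqrt)
qed

text \<open>By Tychonoff: the sphere is a closed subset of a product of compact sets, in the product
  topology on all functions from \<open>nat\<close>.\<close>

lemma compact_unit_sphere_p2:
  assumes "p > 0" "N \<ge> 1"
  shows "compact (unit_sphere_p2 p N :: (nat \<Rightarrow> real ^ 'k::finite) set)"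
proof -
  define R where "R = real N powr (1 / p)"
  \<comment> \<open>A single site carries at most the total mass \<open>N\<close>, whence the radius
    \<open>R\<close>. The singleton factors outside \<open>{1..N}\<close> encode extensionality and
    are compact too.\<close>
  define S where "S i = (if i \<in> {1..N} then cball 0 R else {undefined :: real ^ 'k})" for i
  have coord: "continuous_on UNIV (\<lambda>\<sigma> :: nat \<Rightarrow> real ^ 'k. norm (\<sigma> i) powr p)" for i
    using assms by (intro continuous_on_powr' continuous_intros) auto
  have "compactin (product_topology (\<lambda>i. euclidean) UNIV) (PiE UNIV S)"
    unfolding compactin_PiE by (auto simp: S_def)
  then have "compact (PiE UNIV S)"
    by (simp add: euclidean_product_topology)
  moreover have "closed {\<sigma> :: nat \<Rightarrow> real ^ 'k. 1 / real N * norm_p2_pow p N \<sigma> = 1}"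
  proof (rule closed_Collect_eq)
    show "continuous_on UNIV (\<lambda>\<sigma> :: nat \<Rightarrow> real ^ 'k. 1 / real N * norm_p2_pow p N \<sigma>)"
      unfolding norm_p2_pow_def by (rule continuous_on_mult_left, rule continuous_on_sum, rule coord)
  qed (rule continuous_on_const)
  ultimately have "compact (PiE UNIV S \<inter> {\<sigma>. 1 / real N * norm_p2_pow p N \<sigma> = 1})"
    by (rule compact_Int_closed)
  moreover have "PiE UNIV S \<inter> {\<sigma>. 1 / real N * norm_p2_pow p N \<sigma> = 1} = unit_sphere_p2 p N"
  proof -
    have mem: "\<sigma> \<in> PiE UNIV S \<longleftrightarrow> \<sigma> \<in> configs N \<and> (\<forall>i\<in>{1..N}. norm (\<sigma> i) \<le> R)" for \<sigma>
    proof -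
      have "\<sigma> \<in> PiE UNIV S \<longleftrightarrow> (\<forall>i. \<sigma> i \<in> S i)"
        by (simp add: PiE_iff)
      also have "\<dots> \<longleftrightarrow> (\<forall>i. i \<notin> {1..N} \<longrightarrow> \<sigma> i = undefined) \<and> (\<forall>i\<in>{1..N}. norm (\<sigma> i) \<le> R)"
        unfolding S_def by (metis mem_cball_0 singleton_iff)
      also have "(\<forall>i. i \<notin> {1..N} \<longrightarrow> \<sigma> i = undefined) \<longleftrightarrow> \<sigma> \<in> configs N"
        by (simp add: configs_def PiE_iff extensional_def)
      finally show ?thesis .
    qed
    have "norm (\<sigma> i) \<le> R" if \<sigma>: "\<sigma> \<in> unit_sphere_p2 p N" and "i \<in> {1..N}" for \<sigma> :: "nat \<Rightarrow> real ^ 'k" and i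
    proof -
      have N: "norm_p2_pow p N \<sigma> = real N"
        using assms \<sigma> by (simp add: unit_sphere_p2_def field_simps)
      have "norm (\<sigma> i) powr p \<le> real N"
        unfolding N[symmetric] norm_p2_pow_def
        by (rule member_le_sum[OF that(2), of "\<lambda>i. norm (\<sigma> i) powr p"]) auto
      then have "(norm (\<sigma> i) powr p) powr (1 / p) \<le> R"
        unfolding R_def using assms by (intro powr_mono2) auto
      then show ?thesis
        using assms by (simp add: powr_powr)
    qed
    then show ?thesis
      unfolding set_eq_iff Int_iff mem unfolding unit_sphere_p2_def by blast
  qed
  ultimately show ?thesis by simp
qed

lemma continuous_on_hamiltonian:
  "continuous_on UNIV (hamiltonian N a :: (nat \<Rightarrow> real ^ 'k::finite) \<Rightarrow> real)"
  unfolding hamiltonian_def[abs_def]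
  by (intro continuous_on_mult_left continuous_on_sum continuous_on_inner
      continuous_on_product_coordinates)

text \<open>A continuous function on a nonempty compact set attains its supremum, so
  \<open>max_on\<close> is a genuine maximum here.\<close>

lemma ground_state_energy_attained:
  assumes "p > 0" "N \<ge> 1"
  shows "\<exists>\<sigma> \<in> (unit_sphere_p2 p N :: (nat \<Rightarrow> real ^ 'k::finite) set).
           hamiltonian N a \<sigma> = real N * ground_state_energy TYPE('k) p N a \<and>
           (\<forall>\<tau> \<in> (unit_sphere_p2 p N :: (nat \<Rightarrow> real ^ 'k) set). hamiltonian N a \<tau> \<le> hamiltonian N a \<sigma>)"
proof -
  let ?S = "unit_sphere_p2 p N :: (nat \<Rightarrow> real ^ 'k) set"
  obtain \<sigma> where \<sigma>: "\<sigma> \<in> ?S" and le: "\<And>\<tau>. \<tau> \<in> ?S \<Longrightarrow> hamiltonian N a \<tau> \<le> hamiltonian N a \<sigma>"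
    using continuous_attains_sup[OF compact_unit_sphere_p2[OF assms], where f = "hamiltonian N a"]
      one_site_config_in_sphere[OF assms] continuous_on_subset[OF continuous_on_hamiltonian]
    by blast
  have "real N * ground_state_energy TYPE('k) p N a = hamiltonian N a \<sigma>"
    using assms max_on_eqI[OF \<sigma>, of "hamiltonian N a"] le
    by (simp add: ground_state_energy_def unit_sphere_p2_def)
  then show ?thesis
    using \<sigma> le by (intro bexI[of _ \<sigma>]) auto
qed

lemma hamiltonian_le_ground_state_energy_on_sphere:
  fixes \<tau> :: "nat \<Rightarrow> real ^ 'k::finite"
  assumes "p > 0" "N \<ge> 1" "\<tau> \<in> unit_sphere_p2 p N"
  shows "hamiltonian N a \<tau> \<le> real N * ground_state_energy TYPE('k) p N a"
  using ground_state_energy_attained[OF assms(1,2), where 'k = 'k and a = a] assms(3) by metis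

lemma ground_state_energy_lower_bound:
  assumes "p > 0" "N \<ge> 1"
  shows "real N powr (2 / p - 3 / 2) * a 1 1 \<le> ground_state_energy TYPE('k::finite) p N a"
proof -
  have "real N powr (2 / p - 1 / 2) * a 1 1 \<le> real N * ground_state_energy TYPE('k) p N a"
  proof -
    let ?\<sigma> = "one_site_config p N :: nat \<Rightarrow> real ^ 'k"
    have "hamiltonian N a ?\<sigma> \<le> real N * ground_state_energy TYPE('k) p N a"
      by (rule hamiltonian_le_ground_state_energy_on_sphere[OF assms one_site_config_in_sphere[OF assms]])
    then show ?thesis
      unfolding hamiltonian_one_site_config[OF assms] .
  qed
  moreover have "real N powr (2 / p - 1 / 2) = real N * real N powr (2 / p - 3 / 2)"
    using assms powr_add[of "real N" 1 "2 / p - 3 / 2"] by simp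
  ultimately show ?thesis
    using assms by (simp add: mult.assoc)
qed

text \<open>A configuration of nonzero norm is rescaled onto the sphere, and 2-homogeneity converts
  the bound there into the factor \<open>powr (2 / p)\<close>. The energy may be negative, and
  \<open>\<sigma>\<close> may lie outside \<open>configs N\<close>, since rescaling truncates
  it.\<close>

lemma hamiltonian_le_ground_state_energy:
  fixes \<sigma> :: "nat \<Rightarrow> real ^ 'k::finite"
  assumes "p > 0" "N \<ge> 1"
  shows "hamiltonian N a \<sigma> \<le> real N * ground_state_energy TYPE('k) p N a
           * (norm_p2_pow p N \<sigma> / real N) powr (2 / p)"
proof (cases "norm_p2_pow p N \<sigma> = 0")
  \<comment> \<open>No rescaling is possible here, but all vectors vanish and both sides are 0,
    because \<open>0 powr (2 / p)\<close> is 0.\<close>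
  case True
  then have "\<forall>i\<in>{1..N}. \<sigma> i = 0"
    unfolding norm_p2_pow_def by (subst (asm) sum_nonneg_eq_0_iff) auto
  then show ?thesis
    using True by (simp add: hamiltonian_def)
next
  case False
  define v where "v = norm_p2_pow p N \<sigma> / real N"
  have v: "v > 0"
    using False assms norm_p2_pow_nonneg[of p N \<sigma>] by (simp add: v_def less_le)
  let ?\<tau> = "scale_config N (v powr (- (1 / p))) \<sigma>"
  have "(v powr (- (1 / p))) powr p = 1 / v"
    unfolding powr_powr using assms v powr_minus_divide[of v 1] by simp
  moreover have "norm_p2_pow p N \<sigma> = v * real N"
    using assms by (simp add: v_def)
  ultimately have "norm_p2_pow p N ?\<tau> = real N"
    using v by (simp add: norm_p2_pow_scale_config)
  then have "?\<tau> \<in> unit_sphere_p2 p N"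
    using assms by (simp add: unit_sphere_p2_def scale_config_in_configs)
  then have "hamiltonian N a ?\<tau> \<le> real N * ground_state_energy TYPE('k) p N a"
    by (rule hamiltonian_le_ground_state_energy_on_sphere[OF assms])
  moreover have "(v powr (- (1 / p)))\<^sup>2 = 1 / v powr (2 / p)"
    using v by (simp add: power2_eq_square powr_minus_divide flip: powr_add)
  ultimately show ?thesis
    using v by (simp add: hamiltonian_scale_config v_def[symmetric] field_simps)
qed

section \<open>The Lagrangian as a function of the ground state energy, for fixed
  \<open>N\<close>\<close>

text \<open>Homogeneity reduces the problem to the scalar one along rays. A negative energy acts
  like 0, since the zero configuration is then optimal.\<close>

lemma lagrangian_eq_dual_value:
  assumes "p > 2" "t > 0" "N \<ge> 1"
  shows "lagrangian TYPE('k::finite) p N a t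
           = dual_value p t (max (ground_state_energy TYPE('k) p N a) 0)"
proof -
  define G where "G = ground_state_energy TYPE('k) p N a"
  define u where "u = dual_point p t (max G 0)"
  have p: "p > 0"
    using assms by simp
  obtain \<sigma> :: "nat \<Rightarrow> real ^ 'k" where \<sigma>: "\<sigma> \<in> unit_sphere_p2 p N"
    and H: "hamiltonian N a \<sigma> = real N * G"
    using ground_state_energy_attained[OF p \<open>N \<ge> 1\<close>, of a] unfolding G_def by blast
  \<comment> \<open>The maximiser: a ground state scaled by \<open>sqrt u\<close>, which multiplies
    the Hamiltonian by \<open>u\<close> and the penalty by \<open>u powr (p / 2)\<close>.\<close>
  let ?\<tau> = "scale_config N (sqrt u) \<sigma>"
  let ?f = "\<lambda>\<sigma> :: nat \<Rightarrow> real ^ 'k. hamiltonian N a \<sigma> - t * norm_p2_pow p N \<sigma>"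
  \<comment> \<open>For \<open>G < 0\<close> the point \<open>u\<close> is a power of 0, hence 0, so
    \<open>G\<close> may be replaced by its positive part.\<close>
  have u: "u \<ge> 0" "u * G = u * max G 0"
    by (auto simp: u_def dual_point_def max_def)
  have "sqrt u powr p = u powr (p / 2)"
    using u powr_powr[of u "1 / 2" p] by (simp add: powr_half_sqrt)
  moreover have "norm_p2_pow p N \<sigma> = real N"
    using \<sigma> assms by (simp add: unit_sphere_p2_def field_simps)
  ultimately have "norm_p2_pow p N ?\<tau> = u powr (p / 2) * real N"
    using u by (simp add: norm_p2_pow_scale_config)
  moreover have "hamiltonian N a ?\<tau> = real N * (u * max G 0)"
    unfolding u(2)[symmetric] using u(1) H by (simp add: hamiltonian_scale_config)
  ultimately have "?f ?\<tau> = real N * (max G 0 * u - t * u powr (p / 2))"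
    by (simp add: algebra_simps)
  then have f\<tau>: "?f ?\<tau> = real N * dual_value p t (max G 0)"
    using dual_value_attained[of p t "max G 0"] assms by (simp add: u_def)
  have "?f \<rho> \<le> ?f ?\<tau>" for \<rho>
  proof -
    \<comment> \<open>The scalar variable belonging to \<open>\<rho>\<close>: its penalty is
      \<open>t * N * w powr (p / 2)\<close> and its Hamiltonian is at most
      \<open>N * G * w\<close>.\<close>
    define w where "w = (norm_p2_pow p N \<rho> / real N) powr (2 / p)"
    have w: "w \<ge> 0" "norm_p2_pow p N \<rho> = real N * w powr (p / 2)"
      using assms norm_p2_pow_nonneg[of p N \<rho>] by (auto simp: w_def powr_powr)
    have "hamiltonian N a \<rho> \<le> real N * (G * w)"
      using hamiltonian_le_ground_state_energy[OF p \<open>N \<ge> 1\<close>, of a \<rho>]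
      by (simp add: w_def G_def mult.assoc)
    also have "\<dots> \<le> real N * (max G 0 * w)"
      using w by (intro mult_left_mono mult_right_mono) auto
    finally have "?f \<rho> \<le> real N * (max G 0 * w - t * w powr (p / 2))"
      by (simp add: w algebra_simps)
    also have "\<dots> \<le> real N * dual_value p t (max G 0)"
      using assms w by (intro mult_left_mono dual_value_ge) auto
    finally show ?thesis
      unfolding f\<tau> .
  qed
  then have "max_on ?f (configs N) = ?f ?\<tau>"
    by (intro max_on_eqI scale_config_in_configs)
  then show ?thesis
    using assms unfolding lagrangian_def f\<tau> G_def by simp
qed

lemma lagrangian_nonneg:
  assumes "p > 2" "t > 0" "N \<ge> 1"
  shows "lagrangian TYPE('k::finite) p N a t \<ge> 0"
  using assms by (simp add: lagrangian_eq_dual_value dual_value_def)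

section \<open>Passage to the limit, for one fixed coupling array and then almost surely\<close>

text \<open>Inverting the identity for each \<open>N\<close> gives the limit of the positive part of
  the energy; it remains to see that the negative part tends to 0.\<close>

lemma ground_state_energy_tendsto:
  assumes "p > 2" "t > 0"
    and lim: "(\<lambda>N. lagrangian TYPE('k::finite) p N a t) \<longlonglongrightarrow> l"
  shows "(\<lambda>N. ground_state_energy TYPE('k) p N a)
           \<longlonglongrightarrow> p / 2 * (p / 2 - 1) powr (2 / p - 1) * t powr (2 / p) * l powr (1 - 2 / p)"
    (is "?G \<longlonglongrightarrow> ?c * _")
proof -
  have "?c * lagrangian TYPE('k) p N a t powr (1 - 2 / p) = max (?G N) 0" if "N \<ge> 1" for N
    unfolding lagrangian_eq_dual_value[OF assms(1,2) that]
    by (rule dual_value_inverse[OF assms(1,2) max.cobounded2])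
  then have ev: "\<forall>\<^sub>F N in sequentially.
      ?c * lagrangian TYPE('k) p N a t powr (1 - 2 / p) = max (?G N) 0"
    by (rule eventually_sequentiallyI)
  have "(\<lambda>N. ?c * lagrangian TYPE('k) p N a t powr (1 - 2 / p)) \<longlonglongrightarrow> ?c * l powr (1 - 2 / p)"
  proof (rule tendsto_mult_left, rule tendsto_powr'[OF lim tendsto_const])
    have "\<forall>\<^sub>F N in sequentially. lagrangian TYPE('k) p N a t \<ge> 0"
      by (rule eventually_sequentiallyI[OF lagrangian_nonneg[OF assms(1,2)]])
    \<comment> \<open>At \<open>l = 0\<close> the power is continuous only from the right, with a
      positive exponent; this is where nonnegativity of the Lagrangian enters.\<close>
    then show "l \<noteq> 0 \<or> 1 - 2 / p > 0 \<and> (\<forall>\<^sub>F N in sequentially. lagrangian TYPE('k) p N a t \<ge> 0)"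
      using assms(1) by simp
  qed
  then have pos: "(\<lambda>N. max (?G N) 0) \<longlonglongrightarrow> ?c * l powr (1 - 2 / p)"
    by (rule Lim_transform_eventually[OF _ ev])
  have "2 / p - 3 / 2 < 0"
    using assms by (simp add: field_simps)
  then have "(\<lambda>N. real N powr (2 / p - 3 / 2)) \<longlonglongrightarrow> 0"
    by (rule tendsto_neg_powr[OF _ filterlim_real_sequentially])
  then have bound_lim: "(\<lambda>N. real N powr (2 / p - 3 / 2) * \<bar>a 1 1\<bar>) \<longlonglongrightarrow> 0"
    by (rule tendsto_mult_left_zero)
  \<comment> \<open>The difference is the negative part of the energy, controlled by the one-site
    lower bound.\<close>
  have "norm (max (?G N) 0 - ?G N) \<le> real N powr (2 / p - 3 / 2) * \<bar>a 1 1\<bar>" if "N \<ge> 1" for N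
  proof -
    have "- (real N powr (2 / p - 3 / 2) * \<bar>a 1 1\<bar>) \<le> real N powr (2 / p - 3 / 2) * a 1 1"
      using mult_left_mono[of "- \<bar>a 1 1\<bar>" "a 1 1" "real N powr (2 / p - 3 / 2)"] by simp
    also have "\<dots> \<le> ?G N"
      using assms that by (intro ground_state_energy_lower_bound) auto
    finally show ?thesis
      by (simp add: max_def)
  qed
  then have "\<forall>\<^sub>F N in sequentially.
      norm (max (?G N) 0 - ?G N) \<le> real N powr (2 / p - 3 / 2) * \<bar>a 1 1\<bar>"
    by (rule eventually_sequentiallyI)
  then have "(\<lambda>N. max (?G N) 0 - ?G N) \<longlonglongrightarrow> 0"
    by (rule Lim_null_comparison[OF _ bound_lim])
  from tendsto_diff[OF pos this] show ?thesis
    by simp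
qed

theorem theorem1p3:
  fixes M :: "'w measure"
    and g :: "nat \<Rightarrow> nat \<Rightarrow> 'w \<Rightarrow> real"
    and p :: real
    and L :: "real \<Rightarrow> real"
  assumes "prob_space M"
    and "prob_space.indep_vars M (\<lambda>_. borel) (\<lambda>(i, j). g i j) ({1..} \<times> {1..})"
    and "\<And>i j. i \<ge> 1 \<Longrightarrow> j \<ge> 1 \<Longrightarrow> distributed M lborel (g i j) std_normal_density"
    and "p > 2"
    and L: "AE \<omega> in M. \<forall>t>0.
           (\<lambda>N. lagrangian TYPE('k::finite) p N (\<lambda>i j. g i j \<omega>) t) \<longlonglongrightarrow> L t"
  shows "\<exists>GSE :: real.
           (AE \<omega> in M.
              (\<lambda>N. ground_state_energy TYPE('k) p N (\<lambda>i j. g i j \<omega>)) \<longlonglongrightarrow> GSE) \<and>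
           (\<forall>t>0. GSE = p / 2 * (p / 2 - 1) powr (2 / p - 1) * t powr (2 / p)
                          * L t powr (1 - 2 / p))"
proof -
  define F where "F t = p / 2 * (p / 2 - 1) powr (2 / p - 1) * t powr (2 / p)
                          * L t powr (1 - 2 / p)" for t
  \<comment> \<open>The limit lemma is applied realisation by realisation; the exceptional null set
    comes from \<open>L\<close> and serves all \<open>t > 0\<close> at once.\<close>
  have AE_F: "AE \<omega> in M. \<forall>t>0.
      (\<lambda>N. ground_state_energy TYPE('k) p N (\<lambda>i j. g i j \<omega>)) \<longlonglongrightarrow> F t"
    using L
  proof eventually_elim
    case (elim \<omega>)
    then show ?case
      unfolding F_def by (intro allI impI ground_state_energy_tendsto[OF \<open>p > 2\<close>]) auto
  qed
  \<comment> \<open>\<open>F\<close> is deterministic, so one good realisation suffices: there the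
    same sequence tends to every \<open>F t\<close>, and uniqueness of limits makes \<open>F\<close>
    constant on \<open>t > 0\<close>.\<close>
  obtain \<omega> where \<omega>: "\<forall>t>0. (\<lambda>N. ground_state_energy TYPE('k) p N (\<lambda>i j. g i j \<omega>)) \<longlonglongrightarrow> F t"
    using eventually_happens'[OF prob_space.ae_filter_bot[OF \<open>prob_space M\<close>] AE_F] ..
  have "F 1 = F t" if "t > 0" for t
    using LIMSEQ_unique[OF \<omega>[rule_format, OF zero_less_one] \<omega>[rule_format, OF that]] .
  moreover have "AE \<omega> in M. (\<lambda>N. ground_state_energy TYPE('k) p N (\<lambda>i j. g i j \<omega>)) \<longlonglongrightarrow> F 1"
    using AE_F by eventually_elim simp
  ultimately show ?thesis
    unfolding F_def[symmetric] by blast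
qed

end
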